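(* Let $r\ge 1$ be a fixed integer and consider observations $y_{ij}=\mu_i+\epsilon_{ij}$, $i=1,2,\ldots$, $j=1,\ldots,r$, with $\epsilon_{ij}$ i.i.d. $N(0,1)$, of which the first $p$ groups ($i=1,\ldots,p$) are observed, with $p\to\infty$. Consider the two models $M_1:\mu=0$ and $M_2:\mu=(\mu_1,\ldots,\mu_p)\in\mathbb{R}^p$, where under $M_2$ the parameter $\mu$ is given the prior density $$\pi_g(\mu)=\int_0^\infty \frac{t^{p/2}}{(2\pi)^{p/2}}\,e^{-(t/2)\mu'\mu}\,g(t)\,dt ,$$ where $g$ is a probability density for the precision parameter $t$ such that $0<t<\infty$ with probability one under $g$. Let $BF_{21}$ be the Bayes factor of $M_2$ against $M_1$ based on $(y_{ij})_{1\le i\le p,\,1\le j\le r}$. Then $(P_1,P_2)$-consistency holds; that is, as $p\to\infty$, $\log BF_{21}\to-\infty$ in probability under $P_1$ and $\log BF_{21}\to+\infty$ in probability under $P_2$, where $P_1,P_2$ are the infinite-dimensional marginal distributions of the data under $M_1$ and $M_2$.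
   Context: Bayes factor: $BF_{21}=m_2/m_1$, where $m_i$ is the marginal density of the observed data $(y_{ij})_{1\le i\le p,\,1\le j\le r}$ under $M_i$. Thus $m_1$ is the joint density of the data when $\mu=0$ (i.i.d. $N(0,1)$ entries), and $m_2=\int_{\mathbb{R}^p} f(y\mid\mu)\,\pi_g(\mu)\,d\mu$, where $f(y\mid\mu)$ is the joint density of independent $y_{ij}\sim N(\mu_i,1)$. Infinite-dimensional marginals: $P_1$ is the law of the infinite array $(y_{ij})_{i\ge1,\,1\le j\le r}$ under $M_1$ (all entries i.i.d. $N(0,1)$). $P_2$ is the law of the infinite array under $M_2$: draw $t$ from the density $g$; given $t$, draw $\mu_1,\mu_2,\ldots$ i.i.d. $N(0,1/t)$; given these, draw independent $y_{ij}\sim N(\mu_i,1)$. The restriction of $P_i$ to the first $p$ groups has density $m_i$. $(P_1,P_2)$-consistency means: $\log BF_{21}\to-\infty$ in probability under $P_1$ and $\log BF_{21}\to+\infty$ in probability under $P_2$. *)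

theory Defs
  imports "HOL-Probability.Probability"
begin

text \<open>
  Groups and replicates are indexed from 0: the observed data are the \<open>y (i, j)\<close> with
  \<open>i < p\<close> and \<open>j < r\<close>, and only these components of an infinite array \<open>y\<close> are read by the
  densities below.  A mean vector in $p$-dimensional space is a function on \<open>{..<p}\<close>,
  integrated against the product Lebesgue measure.
\<close>

definition likelihood :: "nat \<Rightarrow> nat \<Rightarrow> (nat \<Rightarrow> real) \<Rightarrow> (nat \<times> nat \<Rightarrow> real) \<Rightarrow> real" where
  "likelihood r p \<mu> y = (\<Prod>i<p. \<Prod>j<r. normal_density (\<mu> i) 1 (y (i, j)))"

text \<open>
  The prior density is extended-real valued because it may be infinite at \<open>\<mu> = 0\<close>.
\<close>

definition prior_density :: "(real \<Rightarrow> real) \<Rightarrow> nat \<Rightarrow> (nat \<Rightarrow> real) \<Rightarrow> ennreal" where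
  "prior_density g p \<mu> =
     (\<integral>\<^sup>+t\<in>{0<..}. ennreal (t powr (real p / 2) / (2 * pi) powr (real p / 2)
        * exp (- (t / 2) * (\<Sum>i<p. (\<mu> i)\<^sup>2)) * g t) \<partial>lborel)"

definition marginal_density1 :: "nat \<Rightarrow> nat \<Rightarrow> (nat \<times> nat \<Rightarrow> real) \<Rightarrow> real" where
  "marginal_density1 r p y = likelihood r p (\<lambda>_. 0) y"

definition marginal_density2 ::
    "nat \<Rightarrow> (real \<Rightarrow> real) \<Rightarrow> nat \<Rightarrow> (nat \<times> nat \<Rightarrow> real) \<Rightarrow> ennreal" where
  "marginal_density2 r g p y =
     (\<integral>\<^sup>+\<mu>. ennreal (likelihood r p \<mu> y) * prior_density g p \<mu> \<partial>(\<Pi>\<^sub>M i\<in>{..<p}. lborel))"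

text \<open>The conversion to a real number loses nothing: see \<open>marginal_density2_finite\<close> below.\<close>

definition bayes_factor21 :: "nat \<Rightarrow> (real \<Rightarrow> real) \<Rightarrow> nat \<Rightarrow> (nat \<times> nat \<Rightarrow> real) \<Rightarrow> real" where
  "bayes_factor21 r g p y = enn2real (marginal_density2 r g p y) / marginal_density1 r p y"

definition law1 :: "nat \<Rightarrow> (nat \<times> nat \<Rightarrow> real) measure" where
  "law1 r = (\<Pi>\<^sub>M ij\<in>UNIV \<times> {..<r}. density lborel std_normal_density)"

definition mean_law :: "real \<Rightarrow> (nat \<Rightarrow> real) measure" where
  "mean_law t = (\<Pi>\<^sub>M i\<in>UNIV. density lborel (normal_density 0 (1 / sqrt t)))"

definition data_law :: "nat \<Rightarrow> (nat \<Rightarrow> real) \<Rightarrow> (nat \<times> nat \<Rightarrow> real) measure" where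
  "data_law r \<mu> = (\<Pi>\<^sub>M ij\<in>UNIV \<times> {..<r}. density lborel (normal_density (\<mu> (fst ij)) 1))"

text \<open>
  The law of the precision is restricted to the positive half-line, where \<open>mean_law\<close> is
  meaningful; it puts no mass elsewhere.
\<close>

definition law2 :: "nat \<Rightarrow> (real \<Rightarrow> real) \<Rightarrow> (nat \<times> nat \<Rightarrow> real) measure" where
  "law2 r g = restrict_space (density lborel g) {0<..} \<bind> (\<lambda>t. mean_law t \<bind> data_law r)"

text \<open>
  Asking for probabilities tending to 1 excludes the degenerate reading in which the events
  are not measurable, since non-measurable sets have measure 0.
\<close>

definition tendsto_at_top_in_prob :: "'a measure \<Rightarrow> (nat \<Rightarrow> 'a \<Rightarrow> real) \<Rightarrow> bool" where
  "tendsto_at_top_in_prob M X \<longleftrightarrow>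
     (\<forall>K. (\<lambda>n. measure M {x \<in> space M. K < X n x}) \<longlonglongrightarrow> 1)"

definition tendsto_at_bot_in_prob :: "'a measure \<Rightarrow> (nat \<Rightarrow> 'a \<Rightarrow> real) \<Rightarrow> bool" where
  "tendsto_at_bot_in_prob M X \<longleftrightarrow>
     (\<forall>K. (\<lambda>n. measure M {x \<in> space M. X n x < K}) \<longlonglongrightarrow> 1)"

definition consistent :: "'a measure \<Rightarrow> 'a measure \<Rightarrow> (nat \<Rightarrow> 'a \<Rightarrow> real) \<Rightarrow> bool" where
  "consistent P1 P2 BF21 \<longleftrightarrow>
     tendsto_at_bot_in_prob P1 (\<lambda>p y. ln (BF21 p y)) \<and>
     tendsto_at_top_in_prob P2 (\<lambda>p y. ln (BF21 p y))"


subsection \<open>Well-definedness\<close>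

lemma measurable_PiM_prob_algebra:
  assumes K: "\<And>i. i \<in> I \<Longrightarrow> K i \<in> measurable N (prob_algebra borel)"
  shows "(\<lambda>a. \<Pi>\<^sub>M i\<in>I. K i a) \<in> measurable N (prob_algebra (\<Pi>\<^sub>M i\<in>I. (borel :: real measure)))"
proof (rule measurable_prob_algebra_generated[OF sets_PiM Int_stable_prod_algebra prod_algebra_sets_into_space])
  have Ka: "prob_space (K i a)" "sets (K i a) = sets borel" if "a \<in> space N" "i \<in> I" for i a
    using measurable_space[OF K[OF that(2)] that(1)] by (auto simp: space_prob_algebra)
  fix a assume a: "a \<in> space N"
  show "prob_space (\<Pi>\<^sub>M i\<in>I. K i a)"
    by (rule prob_space_PiM) (rule Ka(1)[OF a])
  show "sets (\<Pi>\<^sub>M i\<in>I. K i a) = sets (\<Pi>\<^sub>M i\<in>I. (borel :: real measure))"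
    using Ka[OF a] by (intro sets_PiM_cong) auto
next
  fix A assume "A \<in> prod_algebra I (\<lambda>i. borel :: real measure)"
  then obtain J E where A: "A = prod_emb I (\<lambda>i. borel) J (\<Pi>\<^sub>E j\<in>J. E j)"
    and J: "finite J" "J \<subseteq> I" and E: "\<And>i. i \<in> J \<Longrightarrow> E i \<in> sets (borel :: real measure)"
    by (rule prod_algebraE) auto
  have Ka: "prob_space (K i a)" "sets (K i a) = sets borel" if "a \<in> space N" "i \<in> I" for i a
    using measurable_space[OF K[OF that(2)] that(1)] by (auto simp: space_prob_algebra)
  have "emeasure (\<Pi>\<^sub>M i\<in>I. K i a) A = (\<Prod>i\<in>J. emeasure (K i a) (E i))" if a: "a \<in> space N" for a
  proof -
    have "space (K i a) = UNIV" if "i \<in> I" for i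
      using sets_eq_imp_space_eq[OF Ka(2)[OF a that]] by simp
    then have "A = prod_emb I (\<lambda>i. K i a) J (\<Pi>\<^sub>E j\<in>J. E j)"
      unfolding A prod_emb_def by (auto simp: PiE_iff)
    then show ?thesis
      using Ka[OF a] J E by (simp add: subset_iff, intro emeasure_PiM_emb) auto
  qed
  moreover have "(\<lambda>a. \<Prod>i\<in>J. emeasure (K i a) (E i)) \<in> borel_measurable N"
  proof (rule borel_measurable_prod_ennreal)
    fix i assume "i \<in> J"
    then show "(\<lambda>a. emeasure (K i a) (E i)) \<in> borel_measurable N"
      using J E measurable_prob_algebraD[OF K[of i]]
      by (intro measurable_emeasure_kernel[of "K i" N borel]) auto
  qed
  ultimately show "(\<lambda>a. emeasure (\<Pi>\<^sub>M i\<in>I. K i a) A) \<in> borel_measurable N"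
    by (subst measurable_cong) auto
qed

lemma normal_kernel_measurable:
  assumes [measurable]: "m \<in> borel_measurable N" "s \<in> borel_measurable N"
    and s: "\<And>a. a \<in> space N \<Longrightarrow> 0 < s a"
  shows "(\<lambda>a. density lborel (normal_density (m a) (s a))) \<in> measurable N (prob_algebra borel)"
proof (rule measurable_prob_algebraI)
  show "prob_space (density lborel (normal_density (m a) (s a)))" if "a \<in> space N" for a
    using s[OF that] by (rule prob_space_normal_density)
  show "(\<lambda>a. density lborel (normal_density (m a) (s a))) \<in> measurable N (subprob_algebra borel)"
  proof (rule measurable_subprob_algebra)
    fix A :: "real set" assume [measurable]: "A \<in> sets borel"
    have "emeasure (density lborel (normal_density (m a) (s a))) A =
        (\<integral>\<^sup>+x. ennreal (normal_density (m a) (s a) x) * indicator A x \<partial>lborel)" for a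
      by (subst emeasure_density) auto
    then show "(\<lambda>a. emeasure (density lborel (normal_density (m a) (s a))) A) \<in> borel_measurable N"
      unfolding normal_density_def by simp
  qed (auto intro!: prob_space_imp_subprob_space prob_space_normal_density s)
qed

lemma mean_law_measurable:
  "mean_law \<in> measurable (restrict_space borel {0<..}) (prob_algebra (\<Pi>\<^sub>M i\<in>UNIV. borel))"
  unfolding mean_law_def[abs_def]
  by (intro measurable_PiM_prob_algebra normal_kernel_measurable measurable_restrict_space1)
     (auto simp: space_restrict_space)

lemma data_law_measurable:
  "data_law r \<in> measurable (\<Pi>\<^sub>M i\<in>UNIV. borel) (prob_algebra (\<Pi>\<^sub>M ij\<in>UNIV \<times> {..<r}. borel))"
  unfolding data_law_def[abs_def]
  by (intro measurable_PiM_prob_algebra normal_kernel_measurable) auto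

lemma law1_prob_space: "prob_space (law1 r)"
  unfolding law1_def by (intro prob_space_PiM prob_space_normal_density) simp

context
  fixes g :: "real \<Rightarrow> real"
  assumes g: "g \<in> borel_measurable borel"
    and g_prob: "prob_space (density lborel g)"
    and g_pos: "AE t in density lborel g. 0 < t"
begin

lemma precision_law:
  "restrict_space (density lborel g) {0<..} \<in> space (prob_algebra (restrict_space borel {0<..}))"
proof -
  interpret prob_space "density lborel g" by (rule g_prob)
  have "emeasure (density lborel g) {0<..} = 1"
    using g_pos emeasure_eq_1_AE[of "{0<..}"] by simp
  then show ?thesis
    by (auto simp: space_prob_algebra emeasure_restrict_space space_restrict_space
        intro!: prob_spaceI sets_restrict_space_cong)
qed

lemma law2_prob_space: "prob_space (law2 r g)"
  and sets_law2: "sets (law2 r g) = sets (\<Pi>\<^sub>M ij\<in>UNIV \<times> {..<r}. borel)"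
proof -
  have k: "(\<lambda>t. mean_law t \<bind> data_law r) \<in>
      measurable (restrict_space borel {0<..}) (prob_algebra (\<Pi>\<^sub>M ij\<in>UNIV \<times> {..<r}. borel))"
    using mean_law_measurable data_law_measurable by (rule measurable_bind_prob_space)
  show "prob_space (law2 r g)"
    unfolding law2_def using precision_law k by (rule prob_space_bind')
  show "sets (law2 r g) = sets (\<Pi>\<^sub>M ij\<in>UNIV \<times> {..<r}. borel)"
    unfolding law2_def using precision_law k by (rule sets_bind')
qed

end

lemma nn_integral_prior_density:
  assumes g[measurable]: "g \<in> borel_measurable borel" and g0: "\<And>t. 0 \<le> g t"
    and g_prob: "prob_space (density lborel g)" and g_pos: "AE t in density lborel g. 0 < t"
  shows "(\<integral>\<^sup>+\<mu>. prior_density g p \<mu> \<partial>(\<Pi>\<^sub>M i\<in>{..<p}. lborel)) = 1"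
proof -
  interpret P: product_sigma_finite "\<lambda>i::nat. lborel :: real measure" ..
  interpret L: sigma_finite_measure "\<Pi>\<^sub>M i\<in>{..<p}. (lborel :: real measure)"
    by (rule P.sigma_finite) simp
  interpret PL: pair_sigma_finite lborel "\<Pi>\<^sub>M i\<in>{..<p}. (lborel :: real measure)" ..
  let ?N = "\<lambda>t. \<lambda>x. normal_density 0 (1 / sqrt t) x"
  have eq: "t powr (real p / 2) / (2 * pi) powr (real p / 2) * exp (- (t / 2) * (\<Sum>i<p. (\<mu> i)\<^sup>2)) * g t
      = g t * (\<Prod>i<p. ?N t (\<mu> i))" if t: "0 < t" for t \<mu>
  proof -
    have pw: "c powr (real p / 2) = sqrt c ^ p" if "0 < c" for c :: real
      using that by (simp add: powr_half_sqrt[symmetric] powr_powr powr_realpow[symmetric])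
    have "?N t x = sqrt t / sqrt (2 * pi) * exp (- (t / 2) * x\<^sup>2)" for x
      using t by (simp add: normal_density_def real_sqrt_divide power_divide field_simps)
    then have "(\<Prod>i<p. ?N t (\<mu> i)) =
        (sqrt t / sqrt (2 * pi)) ^ p * exp (\<Sum>i<p. - (t / 2) * (\<mu> i)\<^sup>2)"
      by (simp only: prod.distrib prod_constant card_lessThan exp_sum finite_lessThan)
    then show ?thesis
      using t by (simp add: pw power_divide sum_distrib_left sum_negf)
  qed
  have "(\<integral>\<^sup>+\<mu>. prior_density g p \<mu> \<partial>(\<Pi>\<^sub>M i\<in>{..<p}. lborel)) =
      (\<integral>\<^sup>+\<mu>. \<integral>\<^sup>+t. ennreal (g t) * indicator {0<..} t * (\<Prod>i<p. ennreal (?N t (\<mu> i))) \<partial>lborel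
         \<partial>(\<Pi>\<^sub>M i\<in>{..<p}. lborel))"
    unfolding prior_density_def
  proof (intro nn_integral_cong)
    fix \<mu> :: "nat \<Rightarrow> real" and t :: real
    show "ennreal (t powr (real p / 2) / (2 * pi) powr (real p / 2)
          * exp (- (t / 2) * (\<Sum>i<p. (\<mu> i)\<^sup>2)) * g t) * indicator {0<..} t =
        ennreal (g t) * indicator {0<..} t * (\<Prod>i<p. ennreal (?N t (\<mu> i)))"
    proof (cases "0 < t")
      case True
      then show ?thesis
        unfolding eq[OF True] by (simp add: g0 ennreal_mult prod_ennreal prod_nonneg)
    qed simp
  qed
  also have "\<dots> = (\<integral>\<^sup>+t. \<integral>\<^sup>+\<mu>. ennreal (g t) * indicator {0<..} t * (\<Prod>i<p. ennreal (?N t (\<mu> i)))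
      \<partial>(\<Pi>\<^sub>M i\<in>{..<p}. lborel) \<partial>lborel)"
    unfolding normal_density_def by (rule PL.Fubini') measurable
  also have "\<dots> = (\<integral>\<^sup>+t. ennreal (g t) * indicator {0<..} t \<partial>lborel)"
  proof (rule nn_integral_cong)
    fix t :: real
    have 1: "(\<integral>\<^sup>+\<mu>. (\<Prod>i<p. ennreal (?N t (\<mu> i))) \<partial>(\<Pi>\<^sub>M i\<in>{..<p}. lborel)) = 1" if "0 < t"
      using that by (subst P.product_nn_integral_prod) (auto simp: nn_integral_eq_integral)
    have "(\<integral>\<^sup>+\<mu>. ennreal (g t) * indicator {0<..} t * (\<Prod>i<p. ennreal (?N t (\<mu> i)))
        \<partial>(\<Pi>\<^sub>M i\<in>{..<p}. lborel)) = ennreal (g t) * indicator {0<..} t *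
        (\<integral>\<^sup>+\<mu>. (\<Prod>i<p. ennreal (?N t (\<mu> i))) \<partial>(\<Pi>\<^sub>M i\<in>{..<p}. lborel))"
      by (rule nn_integral_cmult) measurable
    then show "(\<integral>\<^sup>+\<mu>. ennreal (g t) * indicator {0<..} t * (\<Prod>i<p. ennreal (?N t (\<mu> i)))
        \<partial>(\<Pi>\<^sub>M i\<in>{..<p}. lborel)) = ennreal (g t) * indicator {0<..} t"
      using 1 by (auto split: split_indicator)
  qed
  also have "\<dots> = emeasure (density lborel g) {0<..}"
    by (simp add: emeasure_density)
  also have "\<dots> = 1"
    using g_pos prob_space.emeasure_eq_1_AE[OF g_prob, of "{0<..}"] by simp
  finally show ?thesis .
qed

lemma marginal_density2_finite:
  assumes g[measurable]: "g \<in> borel_measurable borel" and g0: "\<And>t. 0 \<le> g t"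
    and g_prob: "prob_space (density lborel g)" and g_pos: "AE t in density lborel g. 0 < t"
  shows "marginal_density2 r g p y < \<infinity>"
proof -
  have le: "normal_density m 1 x \<le> 1" for m x :: real
  proof -
    have "1 \<le> sqrt (2 * pi)"
      using pi_ge_two by simp
    then show ?thesis
      unfolding normal_density_def by (intro mult_le_one) auto
  qed
  have "likelihood r p \<mu> y \<le> 1" for \<mu>
    unfolding likelihood_def by (intro prod_le_1 conjI prod_nonneg) (auto simp: le)
  then have "marginal_density2 r g p y \<le> (\<integral>\<^sup>+\<mu>. 1 * prior_density g p \<mu> \<partial>(\<Pi>\<^sub>M i\<in>{..<p}. lborel))"
    unfolding marginal_density2_def by (intro nn_integral_mono mult_right_mono) auto
  also have "\<dots> = 1"
    using nn_integral_prior_density[OF assms] by simp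
  finally show ?thesis
    by (rule le_less_trans) simp
qed

end

theory Submission
  imports Defs
begin

text \<open>
  The Bayes factor is the density of the law of the first \<open>p\<close> groups under $P_2$ with respect
  to the one under $P_1$.  It therefore suffices to find events $A_p$ in the first \<open>p\<close>
  groups with $P_1(A_p) \to 0$ and $P_2(A_p) \to 1$: for $c > 0$,
  $P_1(BF \ge c) \le P_1(A_p) + P_2(A_p^c) / c$ and
  $P_2(BF \le c) \le P_2(A_p^c) + c P_1(A_p)$.
  The averages of $\cos y_{i1}$ over $i \le p$ provide such events, because the mean of a cosine is
  $e^{-1/2}$ under $P_1$ and $e^{-(1+1/t)/2}$, which is strictly smaller, under $P_2$ given \<open>t\<close>,
  and the variance of a cosine is at most 1, so that Chebyshev's inequality applies.  Dominated convergence
  removes the conditioning on \<open>t\<close>.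
\<close>

subsection \<open>Likelihood ratios and separating events\<close>

text \<open>The cosine is the real part of \<open>iexp\<close>. The substitution
  \<open>m + \<sigma> * x\<close> turns the integral into the real part of \<open>iexp m\<close>
  times the characteristic function of the standard normal law at \<open>\<sigma>\<close>, which is
  real.\<close>

lemma integral_cos_normal:
  assumes "0 < \<sigma>"
  shows "(\<integral>x. cos x \<partial>density lborel (normal_density m \<sigma>)) = exp (- \<sigma>\<^sup>2 / 2) * cos m"
proof -
  interpret N: prob_space std_normal_distribution
    by (rule prob_space_normal_density) simp
  have "distributed std_normal_distribution lborel (\<lambda>x. x) std_normal_density"
    by (simp add: distributed_def distr_id2)
  from N.normal_density_affine[OF this, of \<sigma> m] assms
  have "density lborel (normal_density m \<sigma>) = distr std_normal_distribution lborel (\<lambda>x. m + \<sigma> * x)"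
    by (simp add: distributed_def)
  then have "(\<integral>x. cos x \<partial>density lborel (normal_density m \<sigma>)) =
      (\<integral>x. cos (m + \<sigma> * x) \<partial>std_normal_distribution)"
    by (simp add: integral_distr)
  also have "\<dots> = (\<integral>x. Re (iexp m * iexp (\<sigma> * x)) \<partial>std_normal_distribution)"
    by (intro Bochner_Integration.integral_cong)
       (simp_all add: cos_add Re_exp Im_exp)
  also have "\<dots> = Re (\<integral>x. iexp m * iexp (\<sigma> * x) \<partial>std_normal_distribution)"
    by (intro integral_Re N.integrable_const_bound[where B=1]) (auto simp: norm_mult)
  also have "\<dots> = Re (iexp m * char std_normal_distribution \<sigma>)"
    by (simp add: char_def)
  also have "\<dots> = exp (- \<sigma>\<^sup>2 / 2) * cos m"
    by (simp add: char_std_normal_distribution Re_exp)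
  finally show ?thesis .
qed

text \<open>The integrand reads only the coordinates in \<open>K\<close>, so it may be integrated
  against the image of the possibly infinite product under restriction to \<open>K\<close>. That
  image is a finite product, where Fubini applies.\<close>

lemma integral_prod_PiM:
  fixes f :: "'i \<Rightarrow> 'a \<Rightarrow> real"
  assumes M: "\<And>i. prob_space (M i)" and K: "finite K" "K \<subseteq> I"
    and f: "\<And>i. i \<in> K \<Longrightarrow> integrable (M i) (f i)"
  shows "(\<integral>x. (\<Prod>i\<in>K. f i (x i)) \<partial>PiM I M) = (\<Prod>i\<in>K. integral\<^sup>L (M i) (f i))"
proof -
  interpret product_prob_space M I
    using M by (simp add: product_prob_space_def product_prob_space_axioms_def
        product_sigma_finite_def prob_space_imp_sigma_finite)
  have [measurable]: "f i \<in> borel_measurable (M i)" if "i \<in> K" for i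
    using f[OF that] by simp
  have "(\<integral>x. (\<Prod>i\<in>K. f i (x i)) \<partial>PiM I M) = (\<integral>x. (\<Prod>i\<in>K. f i (restrict x K i)) \<partial>PiM I M)"
    by simp
  also have "\<dots> = (\<integral>x. (\<Prod>i\<in>K. f i (x i)) \<partial>distr (PiM I M) (PiM K M) (\<lambda>x. restrict x K))"
    using K by (intro integral_distr[symmetric] measurable_restrict_subset) (auto intro!: borel_measurable_prod)
  also have "\<dots> = (\<Prod>i\<in>K. integral\<^sup>L (M i) (f i))"
    using K f by (simp add: distr_PiM_restrict_finite product_integral_prod)
  finally show ?thesis .
qed

text \<open>Chebyshev's inequality for the sum: the covariances vanish and each second moment is at
  most 1, so the variance is at most \<open>p\<close>, and \<open>p / (p * \<epsilon>)^2\<close> is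
  the claimed bound.\<close>

lemma (in prob_space) sum_uncorrelated_deviation:
  fixes X :: "nat \<Rightarrow> 'a \<Rightarrow> real"
  assumes [measurable]: "\<And>i. X i \<in> borel_measurable M"
    and bound: "\<And>i x. \<bar>X i x\<bar> \<le> 1"
    and mean: "\<And>i. expectation (X i) = a"
    and uncorrelated: "\<And>i j. i \<noteq> j \<Longrightarrow> expectation (\<lambda>x. X i x * X j x) = a\<^sup>2"
    and pos: "0 < p" "0 < \<epsilon>"
  shows "prob {x \<in> space M. real p * \<epsilon> \<le> \<bar>(\<Sum>i<p. X i x) - real p * a\<bar>} \<le> 1 / (real p * \<epsilon>\<^sup>2)"
proof -
  have X: "integrable M (X i)" for i
    using bound by (intro integrable_const_bound[where B=1]) auto
  have XX: "integrable M (\<lambda>x. X i x * X j x)" for i j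
    using bound by (intro integrable_const_bound[where B=1]) (auto simp: abs_mult intro!: mult_le_one)
  have sq: "(\<Sum>i<p. X i x)\<^sup>2 = (\<Sum>i<p. \<Sum>j<p. X i x * X j x)" for x
    by (simp add: power2_eq_square sum_product)
  have S: "integrable M (\<lambda>x. \<Sum>i<p. X i x)" "integrable M (\<lambda>x. (\<Sum>i<p. X i x)\<^sup>2)"
    unfolding sq by (intro Bochner_Integration.integrable_sum X XX)+
  have ES: "expectation (\<lambda>x. \<Sum>i<p. X i x) = real p * a"
    by (simp add: Bochner_Integration.integral_sum X mean)
  \<comment> \<open>Keeping \<open>a^2\<close> on the diagonal as well is generous, but then the
    double sum is \<open>(p * a)^2 + p\<close>, and its first term cancels against the squared mean
    in the variance.\<close>
  have le: "expectation (\<lambda>x. X i x * X j x) \<le> a\<^sup>2 + (if i = j then 1 else 0)" for i j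
  proof (cases "i = j")
    case True
    have "expectation (\<lambda>x. X i x * X j x) \<le> expectation (\<lambda>x. 1)"
      using bound[of i] unfolding True
      by (intro integral_mono XX) (auto simp: abs_square_le_1 power2_eq_square[symmetric])
    then show ?thesis
      using True by (simp add: prob_space) (smt (verit) zero_le_power2)
  qed (simp add: uncorrelated)
  have "expectation (\<lambda>x. (\<Sum>i<p. X i x)\<^sup>2) = (\<Sum>i<p. \<Sum>j<p. expectation (\<lambda>x. X i x * X j x))"
    unfolding sq by (simp add: Bochner_Integration.integral_sum Bochner_Integration.integrable_sum XX)
  also have "\<dots> \<le> (\<Sum>i<p. \<Sum>j<p. a\<^sup>2 + (if i = j then 1 else 0))"
    by (intro sum_mono le)
  also have "\<dots> = (real p * a)\<^sup>2 + real p"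
    by (simp add: sum.distrib power2_eq_square algebra_simps)
  finally have "variance (\<lambda>x. \<Sum>i<p. X i x) \<le> real p"
    using variance_eq[OF S] by (simp add: ES)
  then have "variance (\<lambda>x. \<Sum>i<p. X i x) / (real p * \<epsilon>)\<^sup>2 \<le> real p / (real p * \<epsilon>)\<^sup>2"
    using pos by (intro divide_right_mono) auto
  also have "\<dots> = 1 / (real p * \<epsilon>\<^sup>2)"
    using pos by (simp add: power2_eq_square)
  finally show ?thesis
    using Chebyshev_inequality[of "\<lambda>x. \<Sum>i<p. X i x" "real p * \<epsilon>"] S pos
    unfolding ES by simp
qed

text \<open>Integrating \<open>c \<le> L p\<close> or \<open>L p \<le> c\<close> over a set compares
  its two probabilities up to the factor \<open>c\<close>. Cutting along \<open>A p\<close> leaves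
  pieces that are either small already or small by this comparison. The spaces may change with
  \<open>p\<close>, as the number of observed groups does.\<close>

lemma likelihood_ratio_tendsto:
  fixes Q1 Q2 :: "nat \<Rightarrow> 'a measure" and L :: "nat \<Rightarrow> 'a \<Rightarrow> real"
  assumes Q1: "\<And>p. prob_space (Q1 p)" and Q2: "\<And>p. prob_space (Q2 p)"
    and L[measurable]: "\<And>p. L p \<in> borel_measurable (Q1 p)"
    and dens: "\<And>p. Q2 p = density (Q1 p) (\<lambda>x. ennreal (L p x))"
    and A[measurable]: "\<And>p. A p \<in> sets (Q1 p)"
    and A1: "(\<lambda>p. measure (Q1 p) (A p)) \<longlonglongrightarrow> 0"
    and A2: "(\<lambda>p. measure (Q2 p) (A p)) \<longlonglongrightarrow> 1"
    and c: "0 < c"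
  shows "(\<lambda>p. measure (Q1 p) {x \<in> space (Q1 p). L p x < c}) \<longlonglongrightarrow> 1"
    and "(\<lambda>p. measure (Q2 p) {x \<in> space (Q2 p). c < L p x}) \<longlonglongrightarrow> 1"
proof -
  interpret Q1: prob_space "Q1 p" for p by (rule Q1)
  interpret Q2: prob_space "Q2 p" for p by (rule Q2)
  have sets2[measurable_cong]: "sets (Q2 p) = sets (Q1 p)" for p
    by (simp add: dens)
  have space2: "space (Q2 p) = space (Q1 p)" for p
    by (simp add: dens)
  have A2': "(\<lambda>p. measure (Q2 p) (space (Q2 p) - A p)) \<longlonglongrightarrow> 0"
    using tendsto_diff[OF tendsto_const A2, of 1] by (simp add: Q2.prob_compl sets2)
  have em: "emeasure (Q2 p) B = (\<integral>\<^sup>+x. ennreal (L p x) * indicator B x \<partial>Q1 p)"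
    if "B \<in> sets (Q1 p)" for p B
    using that by (simp add: dens emeasure_density)
  have ge: "c * measure (Q1 p) B \<le> measure (Q2 p) B"
    if [measurable]: "B \<in> sets (Q1 p)" and B: "\<And>x. x \<in> B \<Longrightarrow> c \<le> L p x" for p B
  proof -
    have "ennreal c * emeasure (Q1 p) B = (\<integral>\<^sup>+x. ennreal c * indicator B x \<partial>Q1 p)"
      by (simp add: nn_integral_cmult_indicator)
    also have "\<dots> \<le> emeasure (Q2 p) B"
      unfolding em[OF that(1)] by (intro nn_integral_mono) (auto split: split_indicator intro: ennreal_leI B)
    finally show ?thesis
      using c by (simp add: Q1.emeasure_eq_measure Q2.emeasure_eq_measure ennreal_mult[symmetric])
  qed
  have le: "measure (Q2 p) B \<le> c * measure (Q1 p) B"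
    if [measurable]: "B \<in> sets (Q1 p)" and B: "\<And>x. x \<in> B \<Longrightarrow> L p x \<le> c" for p B
  proof -
    have "emeasure (Q2 p) B \<le> (\<integral>\<^sup>+x. ennreal c * indicator B x \<partial>Q1 p)"
      unfolding em[OF that(1)] by (intro nn_integral_mono) (auto split: split_indicator intro: ennreal_leI B)
    also have "\<dots> = ennreal c * emeasure (Q1 p) B"
      by (simp add: nn_integral_cmult_indicator)
    finally show ?thesis
      using c by (simp add: Q1.emeasure_eq_measure Q2.emeasure_eq_measure ennreal_mult[symmetric])
  qed
  show "(\<lambda>p. measure (Q1 p) {x \<in> space (Q1 p). L p x < c}) \<longlonglongrightarrow> 1"
  proof (rule tendsto_sandwich[OF always_eventually always_eventually, where h="\<lambda>_. 1"])
    show "(\<lambda>p. 1 - (measure (Q1 p) (A p) + measure (Q2 p) (space (Q2 p) - A p) / c)) \<longlonglongrightarrow> 1"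
      using c by (auto intro!: tendsto_eq_intros A1 A2')
    show "\<forall>p. 1 - (measure (Q1 p) (A p) + measure (Q2 p) (space (Q2 p) - A p) / c)
        \<le> measure (Q1 p) {x \<in> space (Q1 p). L p x < c}"
    proof
      fix p
      \<comment> \<open>The exceptional set under \<open>Q1\<close> is split: inside
        \<open>A p\<close> it is small because \<open>A p\<close> is, and outside \<open>A p\<close>
        the bound \<open>c \<le> L p\<close> passes the smallness from \<open>Q2\<close> to
        \<open>Q1\<close>.\<close>
      let ?U = "{x \<in> space (Q1 p). c \<le> L p x}"
      have "c * measure (Q1 p) (?U - A p) \<le> measure (Q2 p) (?U - A p)"
        by (rule ge) auto
      also have "\<dots> \<le> measure (Q2 p) (space (Q2 p) - A p)"
        by (rule Q2.finite_measure_mono) (auto simp: space2 sets2)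
      finally have "measure (Q1 p) (?U - A p) \<le> measure (Q2 p) (space (Q2 p) - A p) / c"
        using c by (simp add: field_simps)
      moreover have "measure (Q1 p) ?U \<le> measure (Q1 p) (A p \<union> (?U - A p))"
        by (rule Q1.finite_measure_mono) auto
      moreover have "\<dots> \<le> measure (Q1 p) (A p) + measure (Q1 p) (?U - A p)"
        by (rule measure_subadditive) auto
      moreover have "measure (Q1 p) {x \<in> space (Q1 p). L p x < c} = 1 - measure (Q1 p) ?U"
        by (subst Q1.prob_compl[symmetric]) (auto intro!: arg_cong[where f="measure (Q1 p)"])
      ultimately show "1 - (measure (Q1 p) (A p) + measure (Q2 p) (space (Q2 p) - A p) / c)
        \<le> measure (Q1 p) {x \<in> space (Q1 p). L p x < c}"
        by linarith
    qed
  qed (auto intro: tendsto_const)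
  show "(\<lambda>p. measure (Q2 p) {x \<in> space (Q2 p). c < L p x}) \<longlonglongrightarrow> 1"
  proof (rule tendsto_sandwich[OF always_eventually always_eventually, where h="\<lambda>_. 1"])
    show "(\<lambda>p. measure (Q2 p) (A p) - c * measure (Q1 p) (A p)) \<longlonglongrightarrow> 1"
      by (auto intro!: tendsto_eq_intros A1 A2)
    show "\<forall>p. measure (Q2 p) (A p) - c * measure (Q1 p) (A p)
        \<le> measure (Q2 p) {x \<in> space (Q2 p). c < L p x}"
    proof
      fix p
      let ?V = "{x \<in> space (Q2 p). c < L p x}"
      \<comment> \<open>Off \<open>?V\<close> the ratio is at most \<open>c\<close>, so this part of
        \<open>A p\<close> has \<open>Q2\<close>-probability at most \<open>c\<close> times a
        \<open>Q1\<close>-probability that tends to 0. Hence almost all \<open>Q2\<close>-mass of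
        \<open>A p\<close> lies in \<open>?V\<close>.\<close>
      have "measure (Q2 p) (A p - ?V) \<le> c * measure (Q1 p) (A p - ?V)"
        using sets.sets_into_space[OF A[of p]] by (intro le) (auto simp: space2)
      also have "\<dots> \<le> c * measure (Q1 p) (A p)"
        using c by (intro mult_left_mono Q1.finite_measure_mono) auto
      finally have "measure (Q2 p) (A p - ?V) \<le> c * measure (Q1 p) (A p)" .
      moreover have "measure (Q2 p) (A p) \<le> measure (Q2 p) (?V \<union> (A p - ?V))"
        by (rule Q2.finite_measure_mono) auto
      moreover have "\<dots> \<le> measure (Q2 p) ?V + measure (Q2 p) (A p - ?V)"
        by (rule measure_subadditive) auto
      ultimately show "measure (Q2 p) (A p) - c * measure (Q1 p) (A p) \<le> measure (Q2 p) ?V"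
        by linarith
    qed
  qed (auto intro: tendsto_const)
qed


subsection \<open>Cosine averages\<close>

lemma sets_data_law: "sets (data_law r \<mu>) = sets (\<Pi>\<^sub>M ij\<in>UNIV \<times> {..<r}. borel)"
  and prob_space_data_law: "prob_space (data_law r \<mu>)"
  and sets_mean_law: "sets (mean_law t) = sets (\<Pi>\<^sub>M i\<in>UNIV. borel)"
  and prob_space_mean_law: "0 < t \<Longrightarrow> prob_space (mean_law t)"
  unfolding data_law_def mean_law_def
  by (auto intro!: sets_PiM_cong prob_space_PiM prob_space_normal_density)

lemma mean_law_in_prob_algebra:
  "0 < t \<Longrightarrow> mean_law t \<in> space (prob_algebra (\<Pi>\<^sub>M i\<in>UNIV. borel))"
  by (simp add: space_prob_algebra sets_mean_law prob_space_mean_law)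

text \<open>Given the means, replicates numbered 0 of distinct groups are independent, so the
  expectation factorizes; \<open>1 \<le> r\<close> makes \<open>(i, 0)\<close> an index of the
  array. A general finite \<open>K\<close> covers both first moments and mixed second
  moments.\<close>

lemma integral_prod_cos_data_law:
  assumes "1 \<le> r" "finite K"
  shows "(\<integral>y. (\<Prod>i\<in>K. cos (y (i, 0))) \<partial>data_law r \<mu>) = (\<Prod>i\<in>K. exp (- 1 / 2) * cos (\<mu> i))"
proof -
  let ?M = "\<lambda>ij :: nat \<times> nat. density lborel (normal_density (\<mu> (fst ij)) 1)"
  have prob: "prob_space (?M ij)" for ij
    by (rule prob_space_normal_density) simp
  have int: "integrable (?M ij) cos" for ij
    using prob[of ij] by (intro finite_measure.integrable_const_bound[where B=1])
      (auto simp: prob_space_def)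
  have inj: "inj_on (\<lambda>i. (i, 0 :: nat)) K"
    by (simp add: inj_on_def)
  have "(\<integral>y. (\<Prod>ij\<in>(\<lambda>i. (i, 0)) ` K. cos (y ij)) \<partial>data_law r \<mu>) =
      (\<Prod>ij\<in>(\<lambda>i. (i, 0)) ` K. integral\<^sup>L (?M ij) cos)"
    unfolding data_law_def using assms
    by (intro integral_prod_PiM prob int) auto
  then show ?thesis
    by (simp add: prod.reindex[OF inj] integral_cos_normal)
qed

lemma integral_prod_cos_mean_law:
  assumes "0 < t" "finite K"
  shows "(\<integral>\<mu>. (\<Prod>i\<in>K. cos (\<mu> i)) \<partial>mean_law t) = exp (- 1 / (2 * t)) ^ card K"
proof -
  let ?M = "\<lambda>i::nat. density lborel (normal_density 0 (1 / sqrt t))"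
  have prob: "prob_space (?M i)" for i
    using assms by (intro prob_space_normal_density) simp
  have int: "integrable (?M i) cos" for i
    using prob by (intro finite_measure.integrable_const_bound[where B=1])
      (auto simp: prob_space_def)
  have "(\<integral>\<mu>. (\<Prod>i\<in>K. cos (\<mu> i)) \<partial>mean_law t) = (\<Prod>i\<in>K. integral\<^sup>L (?M i) cos)"
    unfolding mean_law_def using assms by (intro integral_prod_PiM prob int) auto
  then show ?thesis
    using assms by (simp add: integral_cos_normal power_divide mult.commute)
qed

lemma cond_law_measurable:
  "(\<lambda>t. mean_law t \<bind> data_law r) \<in>
      measurable (restrict_space borel {0<..}) (prob_algebra (\<Pi>\<^sub>M ij\<in>UNIV \<times> {..<r}. borel))"
  using mean_law_measurable data_law_measurable by (rule measurable_bind_prob_space)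

lemma cond_law_in_prob_algebra:
  "0 < t \<Longrightarrow> mean_law t \<bind> data_law r \<in> space (prob_algebra (\<Pi>\<^sub>M ij\<in>UNIV \<times> {..<r}. borel))"
  by (rule measurable_space[OF cond_law_measurable]) (simp add: space_restrict_space)

text \<open>By the tower property, averaging over the noise turns each cosine into
  \<open>exp (- 1 / 2) * cos (\<mu> i)\<close>, and averaging over the mean contributes
  \<open>exp (- 1 / (2 * t))\<close>. The power of \<open>card K\<close> expresses that the groups
  are uncorrelated given \<open>t\<close>, with \<open>y (i, 0)\<close> distributed as N(0, 1 +
  1/t).\<close>

lemma integral_prod_cos_cond_law:
  assumes "1 \<le> r" "0 < t" "finite K"
  shows "(\<integral>y. (\<Prod>i\<in>K. cos (y (i, 0))) \<partial>(mean_law t \<bind> data_law r)) =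
    exp (- (1 + 1 / t) / 2) ^ card K"
proof -
  interpret prob_space "mean_law t"
    using assms by (intro prob_space_mean_law)
  have [measurable]: "(\<lambda>y. y (i, 0)) \<in> borel_measurable (\<Pi>\<^sub>M ij\<in>UNIV \<times> {..<r}. borel)" for i :: nat
    using assms by (intro measurable_component_singleton) auto
  have le1: "\<bar>\<Prod>i\<in>K. cos (f i)\<bar> \<le> 1" for f :: "nat \<Rightarrow> real"
    unfolding abs_prod by (intro prod_le_1) auto
  have "(\<integral>y. (\<Prod>i\<in>K. cos (y (i, 0))) \<partial>(mean_law t \<bind> data_law r)) =
      (\<integral>\<mu>. \<integral>y. (\<Prod>i\<in>K. cos (y (i, 0))) \<partial>data_law r \<mu> \<partial>mean_law t)"
  proof (rule integral_bind[where K="\<Pi>\<^sub>M ij\<in>UNIV \<times> {..<r}. borel" and B=1 and B'=1])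
    show "data_law r \<in> mean_law t \<rightarrow>\<^sub>M subprob_algebra (\<Pi>\<^sub>M ij\<in>UNIV \<times> {..<r}. borel)"
      using data_law_measurable[of r]
      by (simp add: measurable_prob_algebraD measurable_cong_sets[OF sets_mean_law refl])
    show "AE \<mu> in mean_law t. emeasure (data_law r \<mu>) (space (data_law r \<mu>)) \<le> ennreal 1"
      by (simp add: prob_space.emeasure_space_1[OF prob_space_data_law])
    show "finite_measure (mean_law t)"
      by unfold_locales
    show "(\<lambda>y. \<Prod>i\<in>K. cos (y (i, 0)) :: real) \<in> borel_measurable (\<Pi>\<^sub>M ij\<in>UNIV \<times> {..<r}. borel)"
      by measurable
  qed (rule le1)
  also have "\<dots> = (\<integral>\<mu>. exp (- 1 / 2) ^ card K * (\<Prod>i\<in>K. cos (\<mu> i)) \<partial>mean_law t)"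
    using assms by (simp add: integral_prod_cos_data_law prod.distrib)
  also have "\<dots> = (exp (- 1 / 2) * exp (- 1 / (2 * t))) ^ card K"
    using assms by (simp add: integral_prod_cos_mean_law power_mult_distrib)
  also have "exp (- 1 / 2) * exp (- 1 / (2 * t)) = exp (- (1 + 1 / t) / 2)"
    by (simp add: exp_add[symmetric] field_simps)
  finally show ?thesis .
qed

text \<open>The product formula at \<open>{i}\<close> and at \<open>{i, j}\<close> yields the mean
  and the vanishing covariances that Chebyshev's bound asks for. The law \<open>M\<close> is left
  open so that \<open>law1\<close> and the conditional laws given \<open>t\<close> are both
  covered.\<close>

lemma cos_sum_deviation:
  fixes M :: "(nat \<times> nat \<Rightarrow> real) measure"
  assumes r: "1 \<le> r" and M: "prob_space M"
    and sets[measurable_cong]: "sets M = sets (\<Pi>\<^sub>M ij\<in>UNIV \<times> {..<r}. borel)"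
    and E: "\<And>K. finite K \<Longrightarrow> (\<integral>y. (\<Prod>i\<in>K. cos (y (i, 0))) \<partial>M) = a ^ card K"
    and pos: "0 < p" "0 < \<epsilon>"
  shows "measure M {y \<in> space M. real p * \<epsilon> \<le> \<bar>(\<Sum>i<p. cos (y (i, 0))) - real p * a\<bar>}
    \<le> 1 / (real p * \<epsilon>\<^sup>2)"
proof (rule prob_space.sum_uncorrelated_deviation[OF M _ _ _ _ pos])
  have "(\<lambda>y. y (i, 0)) \<in> borel_measurable (\<Pi>\<^sub>M ij\<in>UNIV \<times> {..<r}. borel)" for i :: nat
    using r by (intro measurable_component_singleton) auto
  then show "(\<lambda>y. cos (y (i, 0))) \<in> borel_measurable M" for i
    by measurable
  show "(\<integral>y. cos (y (i, 0)) \<partial>M) = a" for i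
    using E[of "{i}"] by simp
  show "(\<integral>y. cos (y (i, 0)) * cos (y (j, 0)) \<partial>M) = a\<^sup>2" if "i \<noteq> j" for i j
    using E[of "{i, j}"] that by (simp add: power2_eq_square)
qed simp

text \<open>
  The margin $p^{-1/4}$ tends to $0$, so that the threshold eventually exceeds the mean of the
  cosines under every precision \<open>t\<close>, but it is of larger order than the
  standard deviation $p^{-1/2}$ of their average.
\<close>

definition separating_event :: "nat \<Rightarrow> (nat \<times> nat \<Rightarrow> real) \<Rightarrow> bool" where
  "separating_event p y \<longleftrightarrow>
     (\<Sum>i<p. cos (y (i, 0))) < real p * (exp (- 1 / 2) - real p powr (- 1 / 4))"

text \<open>The set \<open>I\<close> of groups is arbitrary because the event is used on infinite
  arrays and also on the space of the first \<open>p\<close> groups.\<close>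

lemma measurable_separating_event:
  assumes "1 \<le> r" "{..<p} \<subseteq> I"
  shows "Measurable.pred (\<Pi>\<^sub>M ij\<in>I \<times> {..<r}. borel) (separating_event p)"
proof -
  have [measurable]: "(\<lambda>y. y (i, 0)) \<in> borel_measurable (\<Pi>\<^sub>M ij\<in>I \<times> {..<r}. borel)" if "i < p" for i :: nat
    using assms that by (intro measurable_component_singleton) auto
  show ?thesis
    unfolding separating_event_def by measurable
qed

text \<open>The event forces the sum below its mean by more than \<open>p\<close> times the margin
  \<open>d\<close>, where \<open>d\<close> is the power -1/4 of \<open>p\<close>. Chebyshev bounds
  this by \<open>1 / (p * d^2)\<close>, which is the power -1/2 of \<open>p\<close>.\<close>

lemma separating_event_law1:
  assumes r: "1 \<le> r"
  shows "(\<lambda>p. measure (law1 r) {y \<in> space (law1 r). separating_event p y}) \<longlonglongrightarrow> 0"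
proof (rule tendsto_sandwich[where f="\<lambda>_. 0"])
  have law1: "law1 r = data_law r (\<lambda>_. 0)"
    by (simp add: law1_def data_law_def)
  interpret prob_space "law1 r"
    by (rule law1_prob_space)
  have sets[measurable_cong]: "sets (law1 r) = sets (\<Pi>\<^sub>M ij\<in>UNIV \<times> {..<r}. borel)"
    unfolding law1 by (rule sets_data_law)
  have [measurable]: "(\<lambda>y. y (i, 0)) \<in> borel_measurable (\<Pi>\<^sub>M ij\<in>UNIV \<times> {..<r}. borel)" for i :: nat
    using r by (intro measurable_component_singleton) auto
  have bound: "prob {y \<in> space (law1 r). separating_event p y} \<le> real p powr (- 1 / 2)" if p: "0 < p" for p
  proof -
    let ?d = "real p powr (- 1 / 4)"
    have "prob {y \<in> space (law1 r). separating_event p y} \<le>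
        prob {y \<in> space (law1 r). real p * ?d \<le> \<bar>(\<Sum>i<p. cos (y (i, 0))) - real p * exp (- 1 / 2)\<bar>}"
      by (rule finite_measure_mono) (auto simp: separating_event_def algebra_simps)
    also have "\<dots> \<le> 1 / (real p * ?d\<^sup>2)"
    proof (rule cos_sum_deviation[OF r law1_prob_space sets])
      show "(\<integral>y. (\<Prod>i\<in>K. cos (y (i, 0))) \<partial>law1 r) = exp (- 1 / 2) ^ card K" if "finite K" for K
        unfolding law1 integral_prod_cos_data_law[OF r that] by simp
    qed (use p in auto)
    also have "\<dots> = real p powr (- 1 / 2)"
    proof -
      have "real p * ?d\<^sup>2 = real p powr (1 / 2)"
        using p powr_add[of "real p" 1 "- 1 / 2"] by (simp add: power2_eq_square powr_add[symmetric])
      then show ?thesis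
        by (simp add: powr_minus_divide)
    qed
    finally show ?thesis .
  qed
  show "\<forall>\<^sub>F p in sequentially. prob {y \<in> space (law1 r). separating_event p y} \<le> real p powr (- 1 / 2)"
    using eventually_gt_at_top[of 0] by eventually_elim (rule bound)
  show "(\<lambda>p. real p powr (- 1 / 2)) \<longlonglongrightarrow> 0"
    by (intro tendsto_neg_powr filterlim_real_sequentially) simp
qed auto

lemma separating_event_cond_law:
  assumes r: "1 \<le> r" and t: "0 < t"
  shows "(\<lambda>p. measure (mean_law t \<bind> data_law r)
      {y \<in> space (mean_law t \<bind> data_law r). separating_event p y}) \<longlonglongrightarrow> 1"
proof (rule tendsto_sandwich)
  let ?M = "mean_law t \<bind> data_law r"
  have M: "prob_space ?M" and sets[measurable_cong]: "sets ?M = sets (\<Pi>\<^sub>M ij\<in>UNIV \<times> {..<r}. borel)"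
    using cond_law_in_prob_algebra[OF t, of r] by (auto simp: space_prob_algebra)
  interpret prob_space ?M by (rule M)
  have [measurable]: "(\<lambda>y. y (i, 0)) \<in> borel_measurable (\<Pi>\<^sub>M ij\<in>UNIV \<times> {..<r}. borel)" for i :: nat
    using r by (intro measurable_component_singleton) auto
  note [measurable] = measurable_separating_event[OF r subset_UNIV]
  define a where "a = exp (- (1 + 1 / t) / 2)"
  \<comment> \<open>Half the gap between the two cosine means: \<open>a + \<epsilon>\<close> and
    \<open>exp (- 1 / 2) - \<epsilon>\<close> coincide. Once the margin is below
    \<open>\<epsilon>\<close>, every sum within \<open>p * \<epsilon>\<close> of its mean lies under
    the threshold.\<close>
  define \<epsilon> where "\<epsilon> = (exp (- 1 / 2) - a) / 2"
  have \<epsilon>: "0 < \<epsilon>"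
    using t by (simp add: \<epsilon>_def a_def field_simps)
  have bound: "1 - 1 / (real p * \<epsilon>\<^sup>2) \<le> prob {y \<in> space ?M. separating_event p y}"
    if p: "0 < p" and d: "real p powr (- 1 / 4) < \<epsilon>" for p
  proof -
    let ?B = "{y \<in> space ?M. real p * \<epsilon> \<le> \<bar>(\<Sum>i<p. cos (y (i, 0))) - real p * a\<bar>}"
    have "prob ?B \<le> 1 / (real p * \<epsilon>\<^sup>2)"
      unfolding a_def by (rule cos_sum_deviation[OF r M sets integral_prod_cos_cond_law[OF r t] p \<epsilon>])
    moreover have "prob (space ?M - ?B) \<le> prob {y \<in> space ?M. separating_event p y}"
    proof (rule finite_measure_mono)
      show "space ?M - ?B \<subseteq> {y \<in> space ?M. separating_event p y}"
      proof safe
        fix y :: "nat \<times> nat \<Rightarrow> real"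
        assume "\<not> real p * \<epsilon> \<le> \<bar>(\<Sum>i<p. cos (y (i, 0))) - real p * a\<bar>"
        then have "(\<Sum>i<p. cos (y (i, 0))) < real p * a + real p * \<epsilon>"
          by linarith
        also have "\<dots> = real p * (exp (- 1 / 2) - \<epsilon>)"
          by (simp add: \<epsilon>_def field_simps)
        also have "\<dots> \<le> real p * (exp (- 1 / 2) - real p powr (- 1 / 4))"
          using d by (intro mult_left_mono) auto
        finally show "separating_event p y"
          by (simp add: separating_event_def)
      qed
    qed auto
    ultimately show ?thesis
      by (subst (asm) prob_compl) auto
  qed
  have "(\<lambda>p. real p powr (- 1 / 4)) \<longlonglongrightarrow> 0"
    by (intro tendsto_neg_powr filterlim_real_sequentially) simp
  then have "\<forall>\<^sub>F p in sequentially. real p powr (- 1 / 4) < \<epsilon>"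
    using \<epsilon> by (rule order_tendstoD)
  then show "\<forall>\<^sub>F p in sequentially. 1 - 1 / (real p * \<epsilon>\<^sup>2) \<le> prob {y \<in> space ?M. separating_event p y}"
    using eventually_gt_at_top[of 0] by eventually_elim (rule bound)
  have "(\<lambda>p. 1 - inverse (real p) * inverse (\<epsilon>\<^sup>2)) \<longlonglongrightarrow> 1 - 0 * inverse (\<epsilon>\<^sup>2)"
    by (intro tendsto_intros lim_inverse_n)
  then show "(\<lambda>p. 1 - 1 / (real p * \<epsilon>\<^sup>2)) \<longlonglongrightarrow> 1"
    by (simp add: divide_inverse)
  show "\<forall>\<^sub>F p in sequentially. prob {y \<in> space ?M. separating_event p y} \<le> 1"
    by simp
qed (rule tendsto_const)

text \<open>The probability under the mixture is the average over \<open>t\<close> of the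
  conditional probabilities. These tend to 1 for each \<open>t\<close>, at a rate that depends on
  \<open>t\<close>; the constant bound 1 permits dominated convergence.\<close>

lemma separating_event_law2:
  assumes r: "1 \<le> r" and g: "g \<in> borel_measurable borel"
    and g_prob: "prob_space (density lborel g)" and g_pos: "AE t in density lborel g. 0 < t"
  shows "(\<lambda>p. measure (law2 r g) {y \<in> space (law2 r g). separating_event p y}) \<longlonglongrightarrow> 1"
proof -
  let ?P = "restrict_space (density lborel g) {0<..}"
  let ?N = "\<Pi>\<^sub>M ij\<in>UNIV \<times> {..<r}. (borel :: real measure)"
  let ?k = "\<lambda>t. mean_law t \<bind> data_law r"
  let ?E = "\<lambda>p. {y \<in> space ?N. separating_event p y}"
  note precision = precision_law[OF g g_prob g_pos]
  have P: "prob_space ?P" and setsP: "sets ?P = sets (restrict_space borel {0<..})"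
    using precision by (auto simp: space_prob_algebra)
  interpret P: prob_space ?P by (rule P)
  have spaceP: "space ?P = {0<..}"
    by (simp add: space_restrict_space)
  have k: "?k \<in> ?P \<rightarrow>\<^sub>M subprob_algebra ?N"
    using cond_law_measurable[of r]
    by (simp add: measurable_prob_algebraD measurable_cong_sets[OF setsP refl])
  have space2: "space (law2 r g) = space ?N"
    by (rule sets_eq_imp_space_eq[OF sets_law2[OF g g_prob g_pos]])
  have spacek: "space (?k t) = space ?N" if "0 < t" for t
    using cond_law_in_prob_algebra[OF that, of r] by (intro sets_eq_imp_space_eq) (auto simp: space_prob_algebra)
  have [measurable]: "?E p \<in> sets ?N" for p
    using measurable_separating_event[OF r subset_UNIV] by measurable
  have "(\<lambda>p. \<integral>t. measure (?k t) (?E p) \<partial>?P) \<longlonglongrightarrow> 1"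
  proof -
    have "(\<lambda>p. \<integral>t. measure (?k t) (?E p) \<partial>?P) \<longlonglongrightarrow> (\<integral>t. 1 \<partial>?P)"
    proof (rule integral_dominated_convergence[where w="\<lambda>_. 1"])
      show "AE t in ?P. (\<lambda>p. measure (?k t) (?E p)) \<longlonglongrightarrow> 1"
        using separating_event_cond_law[OF r] by (intro AE_I2) (simp add: spaceP spacek)
      show "AE t in ?P. norm (measure (?k t) (?E p)) \<le> 1" for p
        using cond_law_in_prob_algebra[of _ r]
        by (intro AE_I2) (auto simp: spaceP space_prob_algebra intro!: prob_space.prob_le_1)
      show "(\<lambda>t. measure (?k t) (?E p)) \<in> borel_measurable ?P" for p
        by (rule measurable_compose[OF k]) measurable
    qed auto
    then show ?thesis
      using P.prob_space by simp
  qed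
  then show ?thesis
    unfolding space2 unfolding law2_def
    by (subst P.measure_bind[OF k]) auto
qed


subsection \<open>The Bayes factor as a density\<close>

text \<open>A finite product measure is determined by its values on boxes, and on a box the
  integrand, indicator included, is a product of functions of single coordinates.\<close>

lemma PiM_density:
  assumes I: "finite I" and M: "product_sigma_finite M"
    and Mf: "product_sigma_finite (\<lambda>i. density (M i) (f i))"
    and f[measurable]: "\<And>i. f i \<in> borel_measurable (M i)"
  shows "PiM I (\<lambda>i. density (M i) (f i)) = density (PiM I M) (\<lambda>x. \<Prod>i\<in>I. f i (x i))"
proof (rule product_sigma_finite.PiM_eqI[OF Mf I, symmetric])
  interpret product_sigma_finite M by (rule M)
  show "sets (density (PiM I M) (\<lambda>x. \<Prod>i\<in>I. f i (x i))) = sets (PiM I (\<lambda>i. density (M i) (f i)))"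
    by (auto intro!: sets_PiM_cong)
  fix A assume "\<And>i. i \<in> I \<Longrightarrow> A i \<in> sets (density (M i) (f i))"
  then have A[measurable]: "A i \<in> sets (M i)" if "i \<in> I" for i
    using that by simp
  have "emeasure (density (PiM I M) (\<lambda>x. \<Prod>i\<in>I. f i (x i))) (Pi\<^sub>E I A) =
      (\<integral>\<^sup>+x. (\<Prod>i\<in>I. f i (x i)) * indicator (Pi\<^sub>E I A) x \<partial>PiM I M)"
    using I by (intro emeasure_density sets_PiM_I_finite A) auto
  also have "\<dots> = (\<integral>\<^sup>+x. (\<Prod>i\<in>I. f i (x i) * indicator (A i) (x i)) \<partial>PiM I M)"
  proof (rule nn_integral_cong)
    \<comment> \<open>Membership in the space supplies extensionality: satisfying every coordinate
      condition alone does not place a function in the box.\<close>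
    fix x assume "x \<in> space (PiM I M)"
    then have "indicator (Pi\<^sub>E I A) x = (\<Prod>i\<in>I. indicator (A i) (x i) :: ennreal)"
      using I by (auto simp: space_PiM PiE_iff indicator_def intro: prod_zero)
    then show "(\<Prod>i\<in>I. f i (x i)) * indicator (Pi\<^sub>E I A) x = (\<Prod>i\<in>I. f i (x i) * indicator (A i) (x i))"
      by (simp add: prod.distrib)
  qed
  also have "\<dots> = (\<Prod>i\<in>I. emeasure (density (M i) (f i)) (A i))"
    using I by (subst product_nn_integral_prod) (auto intro!: prod.cong emeasure_density[symmetric] A)
  finally show "emeasure (density (PiM I M) (\<lambda>x. \<Prod>i\<in>I. f i (x i))) (Pi\<^sub>E I A) =
      (\<Prod>i\<in>I. emeasure (density (M i) (f i)) (A i))" .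
qed

lemma distr_PiM_normal:
  assumes K: "finite K" "K \<subseteq> I" and s: "\<And>i. 0 < s i"
  shows "distr (\<Pi>\<^sub>M i\<in>I. density lborel (normal_density (m i) (s i))) (\<Pi>\<^sub>M i\<in>K. lborel) (\<lambda>x. restrict x K) =
    density (\<Pi>\<^sub>M i\<in>K. lborel) (\<lambda>x. ennreal (\<Prod>i\<in>K. normal_density (m i) (s i) (x i)))"
proof -
  let ?N = "\<lambda>i. density lborel (normal_density (m i) (s i))"
  have N: "prob_space (?N i)" for i
    using s by (rule prob_space_normal_density)
  interpret product_prob_space ?N I
    using N by (simp add: product_prob_space_def product_prob_space_axioms_def
        product_sigma_finite_def prob_space_imp_sigma_finite)
  \<comment> \<open>Only the sigma-algebra of the target enters \<open>distr\<close>, so Lebesgue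
    measure may be exchanged for the normal laws there.\<close>
  have "distr (PiM I ?N) (\<Pi>\<^sub>M i\<in>K. lborel) (\<lambda>x. restrict x K) = distr (PiM I ?N) (PiM K ?N) (\<lambda>x. restrict x K)"
    by (intro distr_cong sets_PiM_cong) auto
  also have "\<dots> = PiM K ?N"
    using K by (rule distr_PiM_restrict_finite)
  also have "\<dots> = density (\<Pi>\<^sub>M i\<in>K. lborel) (\<lambda>x. \<Prod>i\<in>K. ennreal (normal_density (m i) (s i) (x i)))"
    using K by (intro PiM_density product_sigma_finite_axioms product_sigma_finite.intro
        lborel.sigma_finite_measure_axioms) auto
  finally show ?thesis
    by (simp add: prod_ennreal)
qed

lemma distr_data_law:
  "distr (data_law r \<mu>) (\<Pi>\<^sub>M ij\<in>{..<p} \<times> {..<r}. lborel) (\<lambda>y. restrict y ({..<p} \<times> {..<r})) =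
    density (\<Pi>\<^sub>M ij\<in>{..<p} \<times> {..<r}. lborel) (\<lambda>y. ennreal (likelihood r p \<mu> y))"
  unfolding data_law_def likelihood_def
  by (subst distr_PiM_normal) (auto simp: prod.cartesian_product case_prod_unfold)

lemma distr_mean_law:
  "0 < t \<Longrightarrow> distr (mean_law t) (\<Pi>\<^sub>M i\<in>{..<p}. lborel) (\<lambda>\<mu>. restrict \<mu> {..<p}) =
    density (\<Pi>\<^sub>M i\<in>{..<p}. lborel) (\<lambda>\<mu>. ennreal (\<Prod>i<p. normal_density 0 (1 / sqrt t) (\<mu> i)))"
  unfolding mean_law_def by (subst distr_PiM_normal) auto

text \<open>For fixed \<open>t\<close> the Gaussian kernel is the joint density of \<open>p\<close>
  independent N(0, 1/t) variables. In this form the prior is visibly a mixture of the densities in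
  \<open>distr_mean_law\<close>, with an integrand jointly measurable in \<open>t\<close> and
  \<open>\<mu>\<close>.\<close>

lemma prior_density_eq:
  assumes g0: "\<And>t. 0 \<le> g t"
  shows "prior_density g p \<mu> = (\<integral>\<^sup>+t. ennreal (g t) * indicator {0<..} t *
    ennreal (\<Prod>i<p. normal_density 0 (1 / sqrt t) (\<mu> i)) \<partial>lborel)"
  unfolding prior_density_def
proof (intro nn_integral_cong)
  fix t :: real
  have eq: "t powr (real p / 2) / (2 * pi) powr (real p / 2) * exp (- (t / 2) * (\<Sum>i<p. (\<mu> i)\<^sup>2)) =
      (\<Prod>i<p. normal_density 0 (1 / sqrt t) (\<mu> i))" if t: "0 < t"
  proof -
    have pw: "c powr (real p / 2) = sqrt c ^ p" if "0 < c" for c :: real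
      using that by (simp add: powr_half_sqrt[symmetric] powr_powr powr_realpow[symmetric])
    have "normal_density 0 (1 / sqrt t) x = sqrt t / sqrt (2 * pi) * exp (- (t / 2) * x\<^sup>2)" for x
      using t by (simp add: normal_density_def real_sqrt_divide power_divide field_simps)
    then have "(\<Prod>i<p. normal_density 0 (1 / sqrt t) (\<mu> i)) =
        (sqrt t / sqrt (2 * pi)) ^ p * exp (\<Sum>i<p. - (t / 2) * (\<mu> i)\<^sup>2)"
      by (simp only: prod.distrib prod_constant card_lessThan exp_sum finite_lessThan)
    then show ?thesis
      using t by (simp add: pw power_divide sum_distrib_left sum_negf)
  qed
  show "ennreal (t powr (real p / 2) / (2 * pi) powr (real p / 2)
        * exp (- (t / 2) * (\<Sum>i<p. (\<mu> i)\<^sup>2)) * g t) * indicator {0<..} t =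
      ennreal (g t) * indicator {0<..} t * ennreal (\<Prod>i<p. normal_density 0 (1 / sqrt t) (\<mu> i))"
  proof (cases "0 < t")
    case True
    then show ?thesis
      unfolding eq[OF True] by (simp add: g0 ennreal_mult prod_nonneg mult.commute)
  qed simp
qed

section \<open>Measurability and positivity of the densities\<close>

lemma measurable_mean_density[measurable]:
  "(\<lambda>(t, \<mu>). \<Prod>i<p. normal_density 0 (1 / sqrt t) (\<mu> i)) \<in>
    borel_measurable (lborel \<Otimes>\<^sub>M (\<Pi>\<^sub>M i\<in>{..<p}. lborel))"
  unfolding normal_density_def by measurable

lemma measurable_prior_density:
  assumes [measurable]: "g \<in> borel_measurable borel" and g0: "\<And>t. 0 \<le> g t"
  shows "prior_density g p \<in> borel_measurable (\<Pi>\<^sub>M i\<in>{..<p}. lborel)"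
proof -
  have [measurable]: "(\<lambda>(\<mu>, t). \<Prod>i<p. normal_density 0 (1 / sqrt t) (\<mu> i)) \<in>
      borel_measurable ((\<Pi>\<^sub>M i\<in>{..<p}. lborel) \<Otimes>\<^sub>M lborel)"
    unfolding normal_density_def by measurable
  show ?thesis
    unfolding prior_density_eq[OF g0, abs_def] by measurable
qed

lemma measurable_likelihood:
  "(\<lambda>(\<mu>, y). likelihood r p \<mu> y) \<in>
    borel_measurable ((\<Pi>\<^sub>M i\<in>{..<p}. lborel) \<Otimes>\<^sub>M (\<Pi>\<^sub>M ij\<in>{..<p} \<times> {..<r}. lborel))"
proof -
  let ?J = "{..<p} \<times> {..<r}"
  let ?M = "(\<Pi>\<^sub>M i\<in>{..<p}. (lborel :: real measure)) \<Otimes>\<^sub>M (\<Pi>\<^sub>M ij\<in>{..<p} \<times> {..<r}. (lborel :: real measure))"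
  have [measurable]: "(\<lambda>x. snd x (i, j)) \<in> borel_measurable ?M" if "i < p" "j < r" for i j
    using that measurable_compose[OF measurable_snd measurable_component_singleton, of "(i, j)" "?J"] by simp
  have [measurable]: "(\<lambda>x. fst x i) \<in> borel_measurable ?M" if "i < p" for i
    using that measurable_compose[OF measurable_fst measurable_component_singleton, of i "{..<p}"] by simp
  show ?thesis
    unfolding likelihood_def normal_density_def case_prod_unfold
    by (intro borel_measurable_prod) measurable
qed

lemma measurable_likelihood_data:
  "likelihood r p \<mu> \<in> borel_measurable (\<Pi>\<^sub>M ij\<in>{..<p} \<times> {..<r}. lborel)"
proof -
  \<comment> \<open>An arbitrary \<open>\<mu>\<close> need not be extensional and so may lie outside
    the product space. Its restriction lies inside and gives the same likelihood, which is then a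
    section of a jointly measurable function.\<close>
  have "likelihood r p \<mu> = (\<lambda>y. likelihood r p (restrict \<mu> {..<p}) y)"
    by (simp add: likelihood_def fun_eq_iff)
  moreover have pair: "(\<lambda>y. (restrict \<mu> {..<p}, y)) \<in>
      (\<Pi>\<^sub>M ij\<in>{..<p} \<times> {..<r}. lborel) \<rightarrow>\<^sub>M (\<Pi>\<^sub>M i\<in>{..<p}. lborel) \<Otimes>\<^sub>M (\<Pi>\<^sub>M ij\<in>{..<p} \<times> {..<r}. lborel)"
    by (intro measurable_Pair measurable_const measurable_ident_sets) (auto simp: space_PiM)
  ultimately show ?thesis
    using measurable_compose[OF pair measurable_likelihood] by simp
qed

lemma likelihood_pos: "0 < likelihood r p \<mu> y"
  unfolding likelihood_def by (intro prod_pos) (auto simp: normal_density_pos)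

section \<open>Passage between the infinite array and the first \<open>p\<close> groups\<close>

lemma likelihood_cong:
  assumes "\<And>i. i < p \<Longrightarrow> \<mu> i = \<mu>' i" "\<And>i j. i < p \<Longrightarrow> j < r \<Longrightarrow> y (i, j) = y' (i, j)"
  shows "likelihood r p \<mu> y = likelihood r p \<mu>' y'"
  unfolding likelihood_def using assms by (intro prod.cong) auto

lemma bayes_factor21_restrict:
  "bayes_factor21 r g p (restrict y ({..<p} \<times> {..<r})) = bayes_factor21 r g p y"
proof -
  have "likelihood r p \<mu> (restrict y ({..<p} \<times> {..<r})) = likelihood r p \<mu> y" for \<mu>
    by (rule likelihood_cong) auto
  then show ?thesis
    by (simp add: bayes_factor21_def marginal_density1_def marginal_density2_def)
qed

lemma separating_event_restrict:
  assumes "1 \<le> r"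
  shows "separating_event p (restrict y ({..<p} \<times> {..<r})) = separating_event p y"
  using assms by (simp add: separating_event_def)

lemma measure_distr_Collect:
  assumes [measurable]: "f \<in> M \<rightarrow>\<^sub>M N" "Measurable.pred N S"
  shows "measure (distr M N f) {z \<in> space (distr M N f). S z} = measure M {x \<in> space M. S (f x)}"
proof -
  have "f -` {z \<in> space N. S z} \<inter> space M = {x \<in> space M. S (f x)}"
    using measurable_space[OF assms(1)] by auto
  then show ?thesis
    by (simp add: measure_distr)
qed

lemma ln_less_iff_exp: "0 < x \<Longrightarrow> ln x < K \<longleftrightarrow> x < exp (K :: real)"
  and less_ln_iff_exp: "0 < x \<Longrightarrow> K < ln x \<longleftrightarrow> exp K < x"
  by (metis exp_less_cancel_iff exp_ln)+

section \<open>The marginal density under the mixture prior\<close>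

context
  fixes g :: "real \<Rightarrow> real"
  assumes g[measurable]: "g \<in> borel_measurable borel" and g0: "\<And>t. 0 \<le> g t"
    and g_prob: "prob_space (density lborel g)"
    and g_pos: "AE t in density lborel g. 0 < t"
begin

lemma measurable_marginal_density2:
  "marginal_density2 r g p \<in> borel_measurable (\<Pi>\<^sub>M ij\<in>{..<p} \<times> {..<r}. lborel)"
proof -
  interpret P: product_sigma_finite "\<lambda>i::nat. lborel :: real measure" ..
  interpret L: sigma_finite_measure "\<Pi>\<^sub>M i\<in>{..<p}. (lborel :: real measure)"
    by (rule P.sigma_finite) simp
  note [measurable] = measurable_likelihood measurable_prior_density[OF g g0]
  have [measurable]: "(\<lambda>(y, \<mu>). likelihood r p \<mu> y) \<in>
    borel_measurable ((\<Pi>\<^sub>M ij\<in>{..<p} \<times> {..<r}. lborel) \<Otimes>\<^sub>M (\<Pi>\<^sub>M i\<in>{..<p}. lborel))"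
    using measurable_compose[OF measurable_pair_swap' measurable_likelihood] by (simp add: case_prod_unfold)
  show ?thesis
    unfolding marginal_density2_def[abs_def] by measurable
qed

text \<open>The likelihood is positive everywhere, so a vanishing integral would force the prior
  density to vanish almost everywhere, although its total mass is 1.\<close>

lemma marginal_density2_pos: "0 < marginal_density2 r g p y"
proof (rule ccontr)
  let ?N = "\<Pi>\<^sub>M i\<in>{..<p}. (lborel :: real measure)"
  note [measurable] = measurable_prior_density[OF g g0]
  have [measurable]: "(\<lambda>\<mu>. likelihood r p \<mu> y) \<in> borel_measurable ?N"
    unfolding likelihood_def normal_density_def by measurable
  assume "\<not> 0 < marginal_density2 r g p y"
  then have "AE \<mu> in ?N. ennreal (likelihood r p \<mu> y) * prior_density g p \<mu> = 0"
    by (simp add: marginal_density2_def nn_integral_0_iff_AE)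
  then have "AE \<mu> in ?N. prior_density g p \<mu> = 0"
    by eventually_elim (use likelihood_pos[of r p _ y] in \<open>auto simp: ennreal_eq_0_iff not_le[symmetric]\<close>)
  then have "(\<integral>\<^sup>+\<mu>. prior_density g p \<mu> \<partial>?N) = 0"
    by (simp add: nn_integral_0_iff_AE)
  then show False
    using nn_integral_prior_density[OF g g0 g_prob g_pos, of p] by simp
qed

text \<open>Identifies \<open>marginal_density2\<close> as the Lebesgue density of the observed data
  under the second model. The hierarchy is unfolded from \<open>t\<close> through
  \<open>\<mu>\<close> to \<open>y\<close>, and Tonelli's theorem, applied twice, first forms the
  prior density and then the marginal density.\<close>

lemma distr_law2:
  "distr (law2 r g) (\<Pi>\<^sub>M ij\<in>{..<p} \<times> {..<r}. lborel) (\<lambda>y. restrict y ({..<p} \<times> {..<r})) =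
    density (\<Pi>\<^sub>M ij\<in>{..<p} \<times> {..<r}. lborel) (marginal_density2 r g p)" (is "distr _ ?Y ?R = _")
proof (rule measure_eqI)
  interpret P: product_sigma_finite "\<lambda>i::nat. lborel :: real measure" ..
  interpret P': product_sigma_finite "\<lambda>ij::nat \<times> nat. lborel :: real measure" ..
  let ?U = "\<Pi>\<^sub>M i\<in>{..<p}. (lborel :: real measure)"
  let ?A = "\<Pi>\<^sub>M ij\<in>UNIV \<times> {..<r}. (borel :: real measure)"
  let ?P = "restrict_space (density lborel g) {0<..}"
  let ?\<phi> = "\<lambda>t \<mu>. ennreal (\<Prod>i<p. normal_density 0 (1 / sqrt t) (\<mu> i))"
  interpret U: sigma_finite_measure ?U by (rule P.sigma_finite) simp
  interpret Y: sigma_finite_measure ?Y by (rule P'.sigma_finite) simp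
  interpret UY: pair_sigma_finite ?U ?Y ..
  interpret LU: pair_sigma_finite lborel ?U ..
  note [measurable] = measurable_likelihood measurable_likelihood_data
    measurable_prior_density[OF g g0] measurable_marginal_density2
  fix B assume "B \<in> sets (distr (law2 r g) ?Y ?R)"
  then have B[measurable]: "B \<in> sets ?Y" by simp
  have setsA: "sets ?A = sets (\<Pi>\<^sub>M ij\<in>UNIV \<times> {..<r}. lborel)"
    by (intro sets_PiM_cong) auto
  have R[measurable]: "?R \<in> ?A \<rightarrow>\<^sub>M ?Y"
    unfolding measurable_cong_sets[OF setsA refl] by (rule measurable_restrict_subset) auto
  have setsU: "sets (\<Pi>\<^sub>M i\<in>UNIV. (borel :: real measure)) = sets (\<Pi>\<^sub>M i\<in>UNIV. lborel)"
    by (intro sets_PiM_cong) auto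
  \<comment> \<open>The cylinder over \<open>B\<close>: the probability is computed on whole arrays,
    where the kernels of the hierarchy live.\<close>
  define C where "C = ?R -` B \<inter> space ?A"
  have C[measurable]: "C \<in> sets ?A"
    unfolding C_def by measurable
  \<comment> \<open>The conditional probability of \<open>B\<close> given the means, written with
    the likelihood.\<close>
  define h where "h \<mu> = (\<integral>\<^sup>+y. ennreal (likelihood r p \<mu> y) * indicator B y \<partial>?Y)" for \<mu>
  have h[measurable]: "h \<in> borel_measurable ?U"
    unfolding h_def[abs_def] by measurable
  have data: "emeasure (data_law r \<mu>) C = h \<mu>" for \<mu>
  proof -
    have "emeasure (data_law r \<mu>) C = emeasure (distr (data_law r \<mu>) ?Y ?R) B"
      using R sets_eq_imp_space_eq[OF sets_data_law[of r \<mu>]]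
      by (subst emeasure_distr) (auto simp: C_def measurable_cong_sets[OF sets_data_law refl])
    also have "\<dots> = h \<mu>"
      unfolding distr_data_law h_def by (subst emeasure_density) measurable
    finally show ?thesis .
  qed
  \<comment> \<open>Since \<open>h\<close> reads only the first \<open>p\<close> means, its integral
    over the infinite sequence of means reduces to the image of \<open>mean_law t\<close> on
    finitely many coordinates, which has a density.\<close>
  have h_restrict: "h (restrict \<mu> {..<p}) = h \<mu>" for \<mu>
    unfolding h_def by (intro nn_integral_cong arg_cong2[where f="(*)"] arg_cong[where f=ennreal] likelihood_cong) auto
  have cond: "emeasure (mean_law t \<bind> data_law r) C = (\<integral>\<^sup>+\<mu>. ?\<phi> t \<mu> * h \<mu> \<partial>?U)" if t: "0 < t" for t
  proof -
    have restr: "(\<lambda>\<mu>. restrict \<mu> {..<p}) \<in> mean_law t \<rightarrow>\<^sub>M ?U"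
      unfolding measurable_cong_sets[OF trans[OF sets_mean_law setsU] refl]
      by (rule measurable_restrict_subset) auto
    have "emeasure (mean_law t \<bind> data_law r) C = (\<integral>\<^sup>+\<mu>. h (restrict \<mu> {..<p}) \<partial>mean_law t)"
      by (subst emeasure_bind_prob_algebra[OF mean_law_in_prob_algebra[OF t] data_law_measurable C])
        (simp add: data h_restrict)
    also have "\<dots> = (\<integral>\<^sup>+\<mu>. h \<mu> \<partial>distr (mean_law t) ?U (\<lambda>\<mu>. restrict \<mu> {..<p}))"
      using h by (intro nn_integral_distr[OF restr, symmetric]) simp
    also have "\<dots> = (\<integral>\<^sup>+\<mu>. ?\<phi> t \<mu> * h \<mu> \<partial>?U)"
      unfolding distr_mean_law[OF t] normal_density_def by (subst nn_integral_density) auto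
    finally show ?thesis .
  qed
  have "emeasure (distr (law2 r g) ?Y ?R) B = emeasure (law2 r g) C"
    using R sets_eq_imp_space_eq[OF sets_law2[OF g g_prob g_pos, of r]]
    by (subst emeasure_distr) (auto simp: C_def measurable_cong_sets[OF sets_law2[OF g g_prob g_pos] refl])
  also have "\<dots> = (\<integral>\<^sup>+t. emeasure (mean_law t \<bind> data_law r) C \<partial>?P)"
    unfolding law2_def
    by (rule emeasure_bind_prob_algebra[OF precision_law[OF g g_prob g_pos] cond_law_measurable C])
  also have "\<dots> = (\<integral>\<^sup>+t. (\<integral>\<^sup>+\<mu>. ?\<phi> t \<mu> * h \<mu> \<partial>?U) \<partial>?P)"
    by (intro nn_integral_cong cond) (simp add: space_restrict_space)
  also have "\<dots> = (\<integral>\<^sup>+t. ennreal (g t) * ((\<integral>\<^sup>+\<mu>. ?\<phi> t \<mu> * h \<mu> \<partial>?U) * indicator {0<..} t) \<partial>lborel)"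
    by (subst nn_integral_restrict_space, simp, subst nn_integral_density) auto
  also have "\<dots> = (\<integral>\<^sup>+t. (\<integral>\<^sup>+\<mu>. ennreal (g t) * indicator {0<..} t * ?\<phi> t \<mu> * h \<mu> \<partial>?U) \<partial>lborel)"
  proof (rule nn_integral_cong)
    fix t :: real
    have "(\<lambda>\<mu>. ?\<phi> t \<mu> * h \<mu>) \<in> borel_measurable ?U"
      unfolding normal_density_def by measurable
    then have "(\<integral>\<^sup>+\<mu>. ennreal (g t) * indicator {0<..} t * (?\<phi> t \<mu> * h \<mu>) \<partial>?U) =
        ennreal (g t) * indicator {0<..} t * (\<integral>\<^sup>+\<mu>. ?\<phi> t \<mu> * h \<mu> \<partial>?U)"
      by (rule nn_integral_cmult)
    then show "ennreal (g t) * ((\<integral>\<^sup>+\<mu>. ?\<phi> t \<mu> * h \<mu> \<partial>?U) * indicator {0<..} t) =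
        (\<integral>\<^sup>+\<mu>. ennreal (g t) * indicator {0<..} t * ?\<phi> t \<mu> * h \<mu> \<partial>?U)"
      by (simp add: ac_simps)
  qed
  \<comment> \<open>With \<open>t\<close> innermost, the factor \<open>h \<mu>\<close> comes out and
    what remains is the prior density at \<open>\<mu>\<close>.\<close>
  also have "\<dots> = (\<integral>\<^sup>+\<mu>. (\<integral>\<^sup>+t. ennreal (g t) * indicator {0<..} t * ?\<phi> t \<mu> * h \<mu> \<partial>lborel) \<partial>?U)"
    by (rule LU.Fubini'[symmetric]) measurable
  also have "\<dots> = (\<integral>\<^sup>+\<mu>. prior_density g p \<mu> * h \<mu> \<partial>?U)"
    unfolding prior_density_eq[OF g0] normal_density_def
    by (intro nn_integral_cong nn_integral_multc) measurable
  also have "\<dots> = (\<integral>\<^sup>+\<mu>. (\<integral>\<^sup>+y. ennreal (likelihood r p \<mu> y) * prior_density g p \<mu> * indicator B y \<partial>?Y) \<partial>?U)"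
    unfolding h_def by (intro nn_integral_cong, subst nn_integral_cmult[symmetric]) (auto simp: ac_simps)
  also have "\<dots> = (\<integral>\<^sup>+y. (\<integral>\<^sup>+\<mu>. ennreal (likelihood r p \<mu> y) * prior_density g p \<mu> * indicator B y \<partial>?U) \<partial>?Y)"
    by (rule UY.Fubini'[symmetric]) measurable
  also have "\<dots> = (\<integral>\<^sup>+y. marginal_density2 r g p y * indicator B y \<partial>?Y)"
    unfolding marginal_density2_def by (intro nn_integral_cong nn_integral_multc) measurable
  also have "\<dots> = emeasure (density ?Y (marginal_density2 r g p)) B"
    by (simp add: emeasure_density)
  finally show "emeasure (distr (law2 r g) ?Y ?R) B = emeasure (density ?Y (marginal_density2 r g p)) B" .
qed simp

end

section \<open>Consistency, transferred from the laws of the first \<open>p\<close> groups\<close>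

theorem theorem1:
  fixes r :: nat and g :: "real \<Rightarrow> real"
  assumes "r \<ge> 1"
    and "g \<in> borel_measurable borel"
    and "\<And>t. 0 \<le> g t"
    and "prob_space (density lborel g)"
    and "AE t in density lborel g. 0 < t"
  shows "consistent (law1 r) (law2 r g) (bayes_factor21 r g)"
proof -
  let ?J = "\<lambda>p. {..<p} \<times> {..<r}"
  let ?Y = "\<lambda>p. \<Pi>\<^sub>M ij\<in>?J p. (lborel :: real measure)"
  let ?R = "\<lambda>p y. restrict y (?J p) :: nat \<times> nat \<Rightarrow> real"
  let ?A = "\<Pi>\<^sub>M ij\<in>UNIV \<times> {..<r}. (borel :: real measure)"
  let ?BF = "bayes_factor21 r g"
  note g = assms(2-5)
  \<comment> \<open>The images of the two laws on the first \<open>p\<close> groups; it is between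
    these that the Bayes factor is a density.\<close>
  define Q1 where "Q1 p = distr (law1 r) (?Y p) (?R p)" for p
  define Q2 where "Q2 p = distr (law2 r g) (?Y p) (?R p)" for p
  have law1: "law1 r = data_law r (\<lambda>_. 0)"
    by (simp add: law1_def data_law_def)
  have sets1: "sets (law1 r) = sets ?A"
    unfolding law1 by (rule sets_data_law)
  have sets2: "sets (law2 r g) = sets ?A"
    by (rule sets_law2[OF g(1,3,4)])
  have setsA: "sets ?A = sets (\<Pi>\<^sub>M ij\<in>UNIV \<times> {..<r}. lborel)"
    by (intro sets_PiM_cong) auto
  have R: "?R p \<in> ?A \<rightarrow>\<^sub>M ?Y p" for p
    unfolding measurable_cong_sets[OF setsA refl] by (rule measurable_restrict_subset) auto
  have R1[measurable]: "?R p \<in> law1 r \<rightarrow>\<^sub>M ?Y p" and R2[measurable]: "?R p \<in> law2 r g \<rightarrow>\<^sub>M ?Y p" for p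
    using R by (simp_all add: measurable_cong_sets[OF sets1 refl] measurable_cong_sets[OF sets2 refl])
  have m1[measurable]: "marginal_density1 r p \<in> borel_measurable (?Y p)" for p
    unfolding marginal_density1_def[abs_def]
    by (rule measurable_likelihood_data)
  have m2[measurable]: "marginal_density2 r g p \<in> borel_measurable (?Y p)" for p
    by (rule measurable_marginal_density2[OF g])
  have BF[measurable]: "?BF p \<in> borel_measurable (?Y p)" for p
    unfolding bayes_factor21_def[abs_def] by measurable
  have m1_pos: "0 < marginal_density1 r p y" for p y
    by (simp add: marginal_density1_def likelihood_pos)
  have fin: "marginal_density2 r g p y < \<infinity>" for p y
    by (rule marginal_density2_finite[OF g])
  \<comment> \<open>Finiteness matters besides positivity, because \<open>enn2real\<close> sends
    infinity to 0. Positivity is what later turns bounds on \<open>ln\<close> of the Bayes factor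
    into bounds by \<open>exp K\<close>.\<close>
  have BF_pos: "0 < ?BF p y" for p y
    using marginal_density2_pos[OF g, of r p y] fin[of p y] m1_pos[of p y]
    by (simp add: bayes_factor21_def enn2real_positive_iff)
  have Q1: "Q1 p = density (?Y p) (marginal_density1 r p)" for p
    unfolding Q1_def law1 distr_data_law marginal_density1_def ..
  \<comment> \<open>The quotient undoes the factor \<open>marginal_density1\<close>, so by the chain
    rule for densities the Bayes factor carries \<open>Q1 p\<close> to \<open>Q2 p\<close>.\<close>
  have "ennreal (marginal_density1 r p y) * ennreal (?BF p y) = marginal_density2 r g p y" for p y
    using m1_pos[of p y] fin[of p y]
    by (simp add: bayes_factor21_def ennreal_mult[symmetric])
  then have Q2: "Q2 p = density (Q1 p) (\<lambda>y. ennreal (?BF p y))" for p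
    unfolding Q1 by (simp add: Q2_def distr_law2[OF g] density_density_eq)
  have sep[measurable]: "Measurable.pred (?Y p) (separating_event p)" for p
  proof -
    have eq: "sets (?Y p) = sets (\<Pi>\<^sub>M ij\<in>?J p. borel)"
      by (intro sets_PiM_cong) auto
    show ?thesis
      using measurable_separating_event[OF assms(1) order_refl, of p]
      unfolding measurable_cong_sets[OF eq refl] .
  qed
  \<comment> \<open>These move probabilities between the image laws and the laws of whole arrays.
    Neither the Bayes factor nor the separating event changes when the array is restricted.\<close>
  note transfer1 = measure_distr_Collect[OF R1, folded Q1_def]
    and transfer2 = measure_distr_Collect[OF R2, folded Q2_def]
  have prob: "prob_space (Q1 p)" "prob_space (Q2 p)" for p
    unfolding Q1_def Q2_def
    by (intro prob_space.prob_space_distr law1_prob_space law2_prob_space g(1,3,4) R1 R2)+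
  have setsQ1: "sets (Q1 p) = sets (?Y p)" and spaceQ: "space (Q1 p) = space (?Y p)" "space (Q2 p) = space (?Y p)" for p
    by (simp_all add: Q1_def Q2_def)
  let ?E = "\<lambda>p. {z \<in> space (?Y p). separating_event p z}"
  have E1: "(\<lambda>p. measure (Q1 p) (?E p)) \<longlonglongrightarrow> 0"
    using separating_event_law1[OF assms(1)] transfer1[OF sep]
    by (simp add: spaceQ separating_event_restrict[OF assms(1)])
  have E2: "(\<lambda>p. measure (Q2 p) (?E p)) \<longlonglongrightarrow> 1"
    using separating_event_law2[OF assms(1) g(1,3,4)] transfer2[OF sep]
    by (simp add: spaceQ separating_event_restrict[OF assms(1)])
  have "?BF p \<in> borel_measurable (Q1 p)" "?E p \<in> sets (Q1 p)" for p
    by (simp_all add: measurable_cong_sets[OF setsQ1 refl] setsQ1 BF)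
  note lim = likelihood_ratio_tendsto[OF prob this(1) Q2 this(2) E1 E2]
  show ?thesis
    unfolding consistent_def tendsto_at_bot_in_prob_def tendsto_at_top_in_prob_def
  proof (intro conjI allI)
    fix K :: real
    \<comment> \<open>The threshold \<open>c = exp K\<close> on the Bayes factor corresponds to the
      threshold \<open>K\<close> on its logarithm.\<close>
    have "(\<lambda>p. measure (law1 r) {y \<in> space (law1 r). ?BF p (?R p y) < exp K}) \<longlonglongrightarrow> 1"
      using lim(1)[of "exp K"] by (simp add: transfer1)
    then show "(\<lambda>p. measure (law1 r) {y \<in> space (law1 r). ln (?BF p y) < K}) \<longlonglongrightarrow> 1"
      using BF_pos by (simp add: bayes_factor21_restrict ln_less_iff_exp)
    have "(\<lambda>p. measure (law2 r g) {y \<in> space (law2 r g). exp K < ?BF p (?R p y)}) \<longlonglongrightarrow> 1"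
      using lim(2)[of "exp K"] by (simp add: transfer2)
    then show "(\<lambda>p. measure (law2 r g) {y \<in> space (law2 r g). K < ln (?BF p y)}) \<longlonglongrightarrow> 1"
      using BF_pos by (simp add: bayes_factor21_restrict less_ln_iff_exp)
  qed
qed

end
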